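(* Let $K$ be a field of characteristic zero and let $A = K\langle x,y\rangle/\langle xy-yx-x\rangle$. For integers $k \ge 1$, $\ell \ge 0$ put $w_{k,\ell} = (xy^{k}-y^{k}x)x^{\ell} \in A$. Let $$W = \bigoplus_{m\ge 1,\, n\ge 0} K x^{m}y^{n} \subseteq A$$ and let $W' \subseteq A$ be the set of all finite $K$-linear combinations $\sum_{k,\ell} c_{k,\ell}\, w_{k,\ell}$ with $k\ge 1$, $\ell \ge 0$, $c_{k,\ell}\in K$ and $c_{k,\ell}=0$ for all but finitely many pairs $(k,\ell)$. Then $W'$ is a two-sided ideal of $A$. In particular, $W = W'$.
   Context: $K\langle x,y\rangle$ denotes the noncommutative polynomial ring (free associative unital $K$-algebra) in two indeterminates $x,y$, and $\langle xy-yx-x\rangle$ is the two-sided ideal generated by $xy-yx-x$. The images of $x,y$ in the quotient $A$ are again denoted $x,y$, so $xy-yx=x$ in $A$. The algebra $A$ is the universal enveloping algebra of the two-dimensional Lie algebra $Kx\oplus Ky$ with $[x,y]=x$, so by the PBW theorem the monomials $x^my^n$ ($m,n\ge 0$) form a $K$-basis of $A$ and the sum defining $W$ is direct. *)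

theory Defs
  imports "HOL-Library.Poly_Mapping" "HOL-Algebra.Algebraic_Closure_Type"
begin

section \<open>The free algebra \<open>K\<langle>x,y\<rangle>\<close>\<close>

datatype gen = Gx | Gy

text \<open>The free monoid on \<^typ>\<open>gen\<close>, written additively because the convolution product of
  \<^typ>\<open>'a \<Rightarrow>\<^sub>0 'b\<close> multiplies basis elements by adding their indices. It is not commutative.\<close>

datatype word = Word (letters: "gen list")

instantiation word :: monoid_add
begin

definition "0 = Word []"
definition "u + v = Word (letters u @ letters v)"

instance
  by standard (auto simp: zero_word_def plus_word_def)

end

type_synonym 'k free_algebra = "word \<Rightarrow>\<^sub>0 'k"

definition free_x :: "'k::field free_algebra"
  where "free_x = Poly_Mapping.single (Word [Gx]) 1"

definition free_y :: "'k::field free_algebra"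
  where "free_y = Poly_Mapping.single (Word [Gy]) 1"

text \<open>The library shows this only for commutative \<^term>\<open>R\<close>; here it is needed for noncommutative
  rings.\<close>

lemma ring_ring_of_type_algebra: "ring (ring_of_type_algebra :: 'a::ring_1 ring)"
proof -
  have "\<exists>y. x + y = 0" for x :: 'a
    using add.right_inverse by blast
  thus ?thesis
    unfolding ring_of_type_algebra_def using add.right_inverse
    by unfold_locales (auto simp: algebra_simps Units_def)
qed

lemma ideal_ring_of_type_algebra_iff:
  fixes I :: "'a::ring_1 set"
  shows "ideal I ring_of_type_algebra \<longleftrightarrow>
    0 \<in> I \<and> (\<forall>a\<in>I. \<forall>b\<in>I. a + b \<in> I) \<and> (\<forall>a\<in>I. \<forall>r. r * a \<in> I \<and> a * r \<in> I)"
proof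
  assume "ideal I ring_of_type_algebra"
  then interpret ideal I "ring_of_type_algebra :: 'a ring" .
  show "0 \<in> I \<and> (\<forall>a\<in>I. \<forall>b\<in>I. a + b \<in> I) \<and> (\<forall>a\<in>I. \<forall>r. r * a \<in> I \<and> a * r \<in> I)"
    using additive_subgroup.zero_closed[OF is_additive_subgroup]
      additive_subgroup.a_closed[OF is_additive_subgroup] I_l_closed I_r_closed
    by (simp add: ring_of_type_algebra_def)
next
  assume I: "0 \<in> I \<and> (\<forall>a\<in>I. \<forall>b\<in>I. a + b \<in> I) \<and> (\<forall>a\<in>I. \<forall>r. r * a \<in> I \<and> a * r \<in> I)"
  interpret R: ring "ring_of_type_algebra :: 'a ring"
    by (rule ring_ring_of_type_algebra)
  have minus: "- a \<in> I" if "a \<in> I" for a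
    using I that by (metis mult_minus1)
  have inv: "\<ominus>\<^bsub>ring_of_type_algebra\<^esub> a = - a" for a :: 'a
    by (rule R.minus_equality) (auto simp: ring_of_type_algebra_def)
  show "ideal I ring_of_type_algebra"
  proof (rule idealI)
    show "ring (ring_of_type_algebra :: 'a ring)"
      by (rule ring_ring_of_type_algebra)
    show "subgroup I (add_monoid (ring_of_type_algebra :: 'a ring))"
    proof (rule group.subgroupI)
      show "Group.group (add_monoid (ring_of_type_algebra :: 'a ring))"
        by (rule R.a_group)
      show "I \<noteq> {}"
        using I by auto
      show "inv\<^bsub>add_monoid ring_of_type_algebra\<^esub> a \<in> I" if "a \<in> I" for a
        using minus[OF that] inv[of a] by (simp add: a_inv_def)
    qed (use I in \<open>auto simp: ring_of_type_algebra_def\<close>)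
  qed (use I in \<open>auto simp: ring_of_type_algebra_def\<close>)
qed


section \<open>The algebra \<open>A = K\<langle>x,y\<rangle> / \<langle>xy - yx - x\<rangle>\<close>\<close>

definition rel_ideal :: "'k::field free_algebra set"
  where "rel_ideal = Idl\<^bsub>ring_of_type_algebra\<^esub> {free_x * free_y - free_y * free_x - free_x}"

lemma rel_ideal_ideal: "ideal (rel_ideal :: 'k::field free_algebra set) ring_of_type_algebra"
  unfolding rel_ideal_def
  by (rule ring.genideal_ideal[OF ring_ring_of_type_algebra]) (simp add: ring_of_type_algebra_def)

lemma rel_ideal_rel: "free_x * free_y - free_y * free_x - free_x \<in> rel_ideal"
  unfolding rel_ideal_def
  by (rule ring.genideal_self'[OF ring_ring_of_type_algebra]) (simp add: ring_of_type_algebra_def)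

lemma rel_ideal_zero: "0 \<in> rel_ideal"
  and rel_ideal_add: "a \<in> rel_ideal \<Longrightarrow> b \<in> rel_ideal \<Longrightarrow> a + b \<in> rel_ideal"
  and rel_ideal_left: "a \<in> rel_ideal \<Longrightarrow> r * a \<in> rel_ideal"
  and rel_ideal_right: "a \<in> rel_ideal \<Longrightarrow> a * r \<in> rel_ideal"
  using rel_ideal_ideal by (auto simp: ideal_ring_of_type_algebra_iff)

lemma rel_ideal_minus: "a \<in> rel_ideal \<Longrightarrow> - a \<in> rel_ideal"
  using rel_ideal_left[of a "- 1"] by simp

lemma rel_ideal_minimal:
  assumes "ideal I ring_of_type_algebra" "free_x * free_y - free_y * free_x - free_x \<in> I"
  shows "rel_ideal \<subseteq> I"
  unfolding rel_ideal_def
  by (rule ring.genideal_minimal[OF ring_ring_of_type_algebra]) (use assms in auto)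

text \<open>The quotient acts on \<open>K[Y][X]\<close>: \<open>x\<close> as multiplication by \<open>X\<close> and \<open>y\<close> as \<open>Y - X d/dX\<close>. This
  shows that the quotient is nonzero, and later that the monomials \<open>x\<^sup>m y\<^sup>n\<close> are linearly
  independent.\<close>

primrec act_gen :: "gen \<Rightarrow> 'k::field poly poly \<Rightarrow> 'k poly poly" where
  "act_gen Gx v = pCons 0 v"
| "act_gen Gy v = smult [:0, 1:] v - pCons 0 (pderiv v)"

definition act :: "word \<Rightarrow> 'k::field poly poly \<Rightarrow> 'k poly poly"
  where "act w = foldr act_gen (letters w)"

definition rep :: "'k::field free_algebra \<Rightarrow> 'k poly poly \<Rightarrow> 'k poly poly"
  where "rep p v = (\<Sum>w\<in>Poly_Mapping.keys p. smult [:Poly_Mapping.lookup p w:] (act w v))"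

lemma act_gen_add: "act_gen g (u + v) = act_gen g u + act_gen g v"
  by (cases g) (auto simp: pderiv_add smult_add_right)

lemma act_gen_smult: "act_gen g (smult [:c:] v) = smult [:c:] (act_gen g v)"
  by (cases g) (auto simp: pderiv_smult smult_diff_right mult.commute)

lemma act_add: "act w (u + v) = act w u + act w v"
proof -
  have "foldr act_gen gs (u + v) = foldr act_gen gs u + foldr act_gen gs v" for gs
    by (induction gs) (auto simp: act_gen_add)
  thus ?thesis
    by (simp add: act_def)
qed

lemma act_smult: "act w (smult [:c:] v) = smult [:c:] (act w v)"
proof -
  have "foldr act_gen gs (smult [:c:] v) = smult [:c:] (foldr act_gen gs v)" for gs
    by (induction gs) (auto simp: act_gen_smult simp del: smult_pCons)
  thus ?thesis
    by (simp add: act_def)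
qed

lemma act_mult: "act (u + w) v = act u (act w v)"
  by (simp add: act_def plus_word_def)

lemma rep_superset:
  assumes "finite S" "Poly_Mapping.keys p \<subseteq> S"
  shows "rep p v = (\<Sum>w\<in>S. smult [:Poly_Mapping.lookup p w:] (act w v))"
  unfolding rep_def by (rule sum.mono_neutral_left) (use assms in \<open>auto simp: in_keys_iff\<close>)

lemma smult_const_add: "smult [:a + b:] v = smult [:a:] v + smult [:b:] v"
  using smult_add_left[of "[:a:]" "[:b:]" v] by simp

lemma rep_add_left: "rep (p + q) v = rep p v + rep q v"
proof -
  let ?S = "Poly_Mapping.keys p \<union> Poly_Mapping.keys q"
  have "rep (p + q) v = (\<Sum>w\<in>?S. smult [:Poly_Mapping.lookup (p + q) w:] (act w v))"
    by (rule rep_superset) (use keys_add[of p q] in auto)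
  also have "\<dots> = (\<Sum>w\<in>?S. smult [:Poly_Mapping.lookup p w:] (act w v))
      + (\<Sum>w\<in>?S. smult [:Poly_Mapping.lookup q w:] (act w v))"
    by (simp add: lookup_add smult_const_add sum.distrib)
  also have "\<dots> = rep p v + rep q v"
    by (simp add: rep_superset[of ?S])
  finally show ?thesis .
qed

lemma rep_single: "rep (Poly_Mapping.single w c) v = smult [:c:] (act w v)"
  by (simp add: rep_superset[of "{w}"])

lemma rep_0_left: "rep 0 v = 0"
  by (simp add: rep_def)

lemma rep_add_right: "rep p (u + v) = rep p u + rep p v"
  by (simp add: rep_def act_add smult_add_right sum.distrib)

lemma rep_0_right: "rep p 0 = 0"
  using rep_add_right[of p 0 0] by (metis add_0 add_right_cancel)

lemma free_algebra_induct [case_names zero add]: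
  fixes p :: "'k::field free_algebra"
  assumes "P 0" "\<And>p w c. P p \<Longrightarrow> P (p + Poly_Mapping.single w c)"
  shows "P p"
proof (induction p rule: update_induct)
  case const
  show ?case by (rule assms)
next
  case (update f a b)
  have "Poly_Mapping.update a b f = f + Poly_Mapping.single a b"
    using update(1)
    by (intro poly_mapping_eqI) (auto simp: lookup_update lookup_add lookup_single in_keys_iff when_def)
  thus ?case
    using assms update by metis
qed

lemma rep_mult: "rep (p * q) v = rep p (rep q v)"
proof (induction p rule: free_algebra_induct)
  case zero
  show ?case by (simp add: rep_0_left)
next
  case (add p u c)
  have "rep (Poly_Mapping.single u c * q) v = rep (Poly_Mapping.single u c) (rep q v)"
  proof (induction q rule: free_algebra_induct)
    case zero
    show ?case by (simp add: rep_0_left rep_0_right)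
  next
    case (add q w d)
    thus ?case
      by (simp add: distrib_left rep_add_left rep_add_right mult_single rep_single act_mult act_smult
          mult.commute)
  qed
  thus ?case
    using add by (simp add: distrib_right rep_add_left)
qed

lemma rep_minus_left: "rep (p - q) v = rep p v - rep q v"
  using rep_add_left[of "p - q" q v] by simp

lemma rep_1: "rep 1 v = v"
  by (simp add: rep_single act_def zero_word_def flip: single_one one_pCons)

lemma rep_free_x: "rep free_x v = pCons 0 v"
  by (simp add: free_x_def rep_single act_def flip: one_pCons)

lemma rep_free_y: "rep free_y v = smult [:0, 1:] v - pCons 0 (pderiv v)"
  by (simp add: free_y_def rep_single act_def flip: one_pCons)

lemma rep_rel_ideal:
  assumes "p \<in> rel_ideal"
  shows "rep p v = 0"
proof -
  have "rep (free_x * free_y - free_y * free_x - free_x) v = 0" for v :: "'a poly poly"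
    by (simp add: rep_minus_left rep_mult rep_free_x rep_free_y pderiv_pCons)
  hence "rel_ideal \<subseteq> {p :: 'a free_algebra. \<forall>v. rep p v = 0}"
    by (intro rel_ideal_minimal)
       (auto simp: ideal_ring_of_type_algebra_iff rep_0_left rep_0_right rep_add_left rep_mult)
  thus ?thesis
    using assms by auto
qed

lemma one_notin_rel_ideal: "1 \<notin> (rel_ideal :: 'k::field free_algebra set)"
  using rep_rel_ideal[of "1 :: 'k free_algebra" 1] by (auto simp: rep_1)

quotient_type (overloaded) 'k alg = "'k::field free_algebra" / "\<lambda>p q. p - q \<in> rel_ideal"
proof (rule equivpI)
  show "reflp (\<lambda>p q. p - q \<in> rel_ideal)"
    by (rule reflpI) (simp add: rel_ideal_zero)
  show "symp (\<lambda>p q. p - q \<in> rel_ideal)"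
    by (rule sympI) (metis rel_ideal_minus minus_diff_eq)
  show "transp (\<lambda>p q. p - q \<in> rel_ideal)"
    by (rule transpI) (metis rel_ideal_add diff_add_cancel add_diff_eq)
qed

instantiation alg :: (field) ring_1
begin

lift_definition zero_alg :: "'a alg" is 0 .

lift_definition one_alg :: "'a alg" is 1 .

lift_definition plus_alg :: "'a alg \<Rightarrow> 'a alg \<Rightarrow> 'a alg" is "(+)"
  by (metis rel_ideal_add add_diff_add)

lift_definition uminus_alg :: "'a alg \<Rightarrow> 'a alg" is "uminus"
  by (metis rel_ideal_minus minus_diff_minus)

lift_definition minus_alg :: "'a alg \<Rightarrow> 'a alg \<Rightarrow> 'a alg" is "(-)"
proof -
  fix a b c d :: "'a free_algebra"
  assume "a - b \<in> rel_ideal" "c - d \<in> rel_ideal"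
  moreover have "a - c - (b - d) = (a - b) + - (c - d)"
    by simp
  ultimately show "a - c - (b - d) \<in> rel_ideal"
    by (metis rel_ideal_add rel_ideal_minus)
qed

lift_definition times_alg :: "'a alg \<Rightarrow> 'a alg \<Rightarrow> 'a alg" is "(*)"
proof -
  fix a b c d :: "'a free_algebra"
  assume "a - b \<in> rel_ideal" "c - d \<in> rel_ideal"
  moreover have "a * c - b * d = (a - b) * c + b * (c - d)"
    by (simp add: algebra_simps)
  ultimately show "a * c - b * d \<in> rel_ideal"
    by (metis rel_ideal_add rel_ideal_left rel_ideal_right)
qed

instance
proof
  show "(0 :: 'a alg) \<noteq> 1"
    by transfer (metis one_notin_rel_ideal rel_ideal_minus diff_0 minus_minus)
qed (transfer; simp add: algebra_simps rel_ideal_zero)+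

end

lift_definition alg_x :: "'k::field alg" is free_x .

lift_definition alg_y :: "'k::field alg" is free_y .

text \<open>Scalar multiplication by \<open>c\<close> is multiplication by the constant \<open>c\<close>, i.e.\ by \<open>c\<close> times the
  empty word.\<close>

lift_definition scale :: "'k::field \<Rightarrow> 'k alg \<Rightarrow> 'k alg"
  is "\<lambda>c p. Poly_Mapping.single 0 c * p"
  by (metis rel_ideal_left right_diff_distrib)

global_interpretation alg: vector_space "scale :: 'k::field \<Rightarrow> 'k alg \<Rightarrow> 'k alg"
  defines alg_span = alg.span
proof
  fix a b :: 'k and u v :: "'k alg"
  show "scale a (u + v) = scale a u + scale a v"
    by transfer (simp add: algebra_simps rel_ideal_zero)
  show "scale (a + b) u = scale a u + scale b u"
    by transfer (simp add: algebra_simps rel_ideal_zero single_add)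
  show "scale a (scale b u) = scale (a * b) u"
    by transfer (simp add: mult.assoc[symmetric] mult_single rel_ideal_zero)
  show "scale 1 u = u"
    by transfer (simp add: rel_ideal_zero)
qed

lemma alg_relation: "alg_x * alg_y - alg_y * alg_x = (alg_x :: 'k::field alg)"
  by transfer (rule rel_ideal_rel)


section \<open>The subspaces \<open>W\<close> and \<open>W'\<close>\<close>

text \<open>\<open>W\<close> is the sum of the lines \<open>K x\<^sup>m y\<^sup>n\<close> with \<open>m \<ge> 1\<close>; that this sum is direct is
  \<open>alg_monomials_independent\<close> below.\<close>

definition W :: "'k::field alg set"
  where "W = alg_span {alg_x ^ m * alg_y ^ n | m n. m \<ge> 1}"

definition w :: "nat \<Rightarrow> nat \<Rightarrow> 'k::field alg"
  where "w k l = (alg_x * alg_y ^ k - alg_y ^ k * alg_x) * alg_x ^ l"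

definition W' :: "'k::field alg set"
  where "W' = {\<Sum>(k, l)\<in>{(k, l). c k l \<noteq> 0}. scale (c k l) (w k l) | c.
    finite {(k, l). c k l \<noteq> 0} \<and> (\<forall>k l. c k l \<noteq> 0 \<longrightarrow> k \<ge> 1)}"

lift_definition alg_rep :: "'k::field alg \<Rightarrow> 'k poly poly \<Rightarrow> 'k poly poly" is rep
  using rep_rel_ideal rep_minus_left by (metis eq_iff_diff_eq_0 ext)

lemma alg_rep_simps:
  "alg_rep 0 v = 0"
  "alg_rep 1 v = v"
  "alg_rep (a + b) v = alg_rep a v + alg_rep b v"
  "alg_rep (a * b) v = alg_rep a (alg_rep b v)"
  "alg_rep (scale c a) v = smult [:c:] (alg_rep a v)"
  "alg_rep alg_x v = pCons 0 v"
  "alg_rep alg_y v = smult [:0, 1:] v - pCons 0 (pderiv v)"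
  by (transfer; simp add: rep_0_left rep_1 rep_add_left rep_mult rep_single rep_free_x rep_free_y
      act_def zero_word_def)+

lemma alg_rep_monomial: "alg_rep (alg_x ^ m * alg_y ^ n) 1 = monom (monom 1 n) m"
proof -
  have y: "alg_rep (alg_y ^ n) 1 = [:monom 1 n:]"
  proof (induction n)
    case (Suc n)
    thus ?case
      by (simp add: alg_rep_simps pderiv_pCons monom_Suc)
  qed (simp add: alg_rep_simps one_pCons)
  show ?thesis
  proof (induction m)
    case (Suc m)
    thus ?case
      by (simp add: alg_rep_simps monom_Suc mult.assoc)
  qed (simp add: alg_rep_simps y monom_0)
qed

lemma alg_monomials_independent:
  "alg.independent (range (\<lambda>(m, n). alg_x ^ m * alg_y ^ n :: 'k::field alg))"
  and alg_monomials_inj: "inj (\<lambda>(m, n). alg_x ^ m * alg_y ^ n :: 'k::field alg)"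
proof -
  define b :: "nat \<times> nat \<Rightarrow> 'k alg" where "b = (\<lambda>(m, n). alg_x ^ m * alg_y ^ n)"
  have coeff_b: "coeff (coeff (alg_rep (b q) 1) m) n = (if q = (m, n) then 1 else 0)" for q m n
    by (cases q) (auto simp: b_def alg_rep_monomial)
  have inj_b: "inj b"
  proof (rule injI)
    fix p q assume eq: "b p = b q"
    obtain m n where p: "p = (m, n)"
      by (cases p)
    have "(1 :: 'k) = (if q = (m, n) then 1 else 0)"
      using coeff_b[of p m n] coeff_b[of q m n] unfolding eq by (simp add: p)
    thus "p = q"
      by (simp add: p split: if_splits)
  qed
  thus "inj (\<lambda>(m, n). alg_x ^ m * alg_y ^ n :: 'k alg)"
    by (simp only: b_def)
  have "alg.independent (range b)"
    unfolding alg.independent_explicit_module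
  proof (intro allI impI)
    fix T f a
    assume T: "finite T" "T \<subseteq> range b" and sum0: "(\<Sum>a\<in>T. scale (f a) a) = 0" and "a \<in> T"
    then obtain m n where a: "a = b (m, n)"
      by auto
    define L :: "'k alg \<Rightarrow> 'k" where "L = (\<lambda>u. coeff (coeff (alg_rep u 1) m) n)"
    have L_sum: "L (\<Sum>a\<in>T. scale (f a) a) = (\<Sum>a\<in>T. f a * L a)"
      using T(1) by (induction T rule: finite_induct) (auto simp: L_def alg_rep_simps)
    have "L a' = (if a' = a then 1 else 0)" if "a' \<in> T" for a'
    proof -
      obtain q where q: "a' = b q"
        using T(2) \<open>a' \<in> T\<close> by blast
      show ?thesis
        by (simp add: L_def a q coeff_b inj_eq[OF inj_b])
    qed
    hence "(\<Sum>a\<in>T. f a * L a) = (\<Sum>a'\<in>T. if a' = a then f a' else 0)"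
      by (intro sum.cong) auto
    also have "\<dots> = f a"
      using \<open>a \<in> T\<close> T(1) by simp
    finally show "f a = 0"
      using sum0 L_sum by (simp add: L_def alg_rep_simps)
  qed
  thus "alg.independent (range (\<lambda>(m, n). alg_x ^ m * alg_y ^ n :: 'k alg))"
    unfolding b_def .
qed

end

theory Submission
  imports Defs
begin

text \<open>
  The relation reads \<open>xy = (y + 1)x\<close>, so \<open>x\<^sup>m p(y) = p(y + m) x\<^sup>m\<close>. Hence \<open>W\<close> is also spanned by the
  reversed monomials \<open>y\<^sup>n x\<^sup>m\<close> with \<open>m \<ge> 1\<close>; each of the two spanning sets makes closure under
  one-sided multiplication by \<open>x\<close> and \<open>y\<close> evident on one side or the other, and so \<open>W\<close> is an
  ideal. Moreover \<open>w\<^sub>k\<^sub>,\<^sub>l = ((y + 1)\<^sup>k - y\<^sup>k) x\<^sup>l\<^sup>+\<^sup>1\<close>, where the polynomial \<open>(y + 1)\<^sup>k - y\<^sup>k\<close> has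
  degree \<open>k - 1\<close> with leading coefficient \<open>k \<noteq> 0\<close>; by triangularity the \<open>w\<^sub>k\<^sub>,\<^sub>l\<close> span \<open>W\<close> as well.
\<close>

section \<open>Scalars and induction in \<open>A\<close>\<close>

text \<open>The index \<open>0\<close> is the empty word, neutral on both sides, so constants are
  central. This lets scalars pass a factor on their left in \<open>scale_mult_right\<close>.\<close>

lemma single_zero_commute:
  "Poly_Mapping.single 0 c * p = p * Poly_Mapping.single 0 c"
  for p :: "'k::field free_algebra"
  by (induction p rule: free_algebra_induct) (auto simp: algebra_simps mult_single)

lemma scale_mult_left: "scale c a * b = scale c (a * b)"
  by transfer (simp add: mult.assoc rel_ideal_zero)

lemma scale_mult_right: "a * scale c b = scale c (a * b)"
  by transfer (metis diff_self mult.assoc rel_ideal_zero single_zero_commute)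

lemma scale_of_nat: "scale (of_nat n) a = of_nat n * a"
  by (induction n) (auto simp: alg.scale_left_distrib algebra_simps)

text \<open>Words span the free algebra, and each word arises from the empty one by prepending
  letters, so only left factors \<open>alg_x\<close> and \<open>alg_y\<close> have to be
  treated.\<close>

lemma alg_induct [case_names zero one add scale x y]:
  fixes a :: "'k::field alg"
  assumes "P 0" "P 1"
    and add: "\<And>a b. P a \<Longrightarrow> P b \<Longrightarrow> P (a + b)"
    and scale: "\<And>c a. P a \<Longrightarrow> P (scale c a)"
    and x: "\<And>a. P a \<Longrightarrow> P (alg_x * a)"
    and y: "\<And>a. P a \<Longrightarrow> P (alg_y * a)"
  shows "P a"
proof -
  have letters: "P (abs_alg (Poly_Mapping.single (Word gs) 1))" for gs
  proof (induction gs)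
    case Nil
    have "abs_alg (Poly_Mapping.single (Word []) 1) = (1 :: 'k alg)"
      by (simp add: one_alg_def flip: zero_word_def)
    thus ?case
      using \<open>P 1\<close> by simp
  next
    case (Cons g gs)
    have "Poly_Mapping.single (Word (g # gs)) (1 :: 'k)
        = (case g of Gx \<Rightarrow> free_x | Gy \<Rightarrow> free_y) * Poly_Mapping.single (Word gs) 1"
      by (cases g) (auto simp: free_x_def free_y_def mult_single plus_word_def)
    hence "abs_alg (Poly_Mapping.single (Word (g # gs)) (1 :: 'k))
        = (case g of Gx \<Rightarrow> alg_x | Gy \<Rightarrow> alg_y) * abs_alg (Poly_Mapping.single (Word gs) 1)"
      by (cases g) (auto simp: alg_x_def alg_y_def times_alg.abs_eq)
    thus ?case
      using Cons x y by (cases g) auto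
  qed
  have "P (abs_alg p)" for p
  proof (induction p rule: free_algebra_induct)
    case zero
    show ?case
      using \<open>P 0\<close> by (simp add: zero_alg_def)
  next
    case (add p u c)
    obtain gs where u: "u = Word gs"
      by (cases u)
    have "Poly_Mapping.single u c = Poly_Mapping.single 0 c * Poly_Mapping.single u 1"
      by (simp add: mult_single)
    hence "abs_alg (p + Poly_Mapping.single u c)
        = abs_alg p + scale c (abs_alg (Poly_Mapping.single (Word gs) 1))"
      by (simp add: plus_alg.abs_eq scale.abs_eq u)
    thus ?case
      using add.IH letters assms(3,4) by metis
  qed
  thus ?thesis
    by (induction a rule: alg.abs_induct) auto
qed

text \<open>Linearity of \<open>f\<close> reduces the claim to generators. The intended maps are
  left and right multiplication by a fixed element, both linear because scalars are central.\<close>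

lemma span_image_closed:
  assumes "a \<in> alg_span S"
    and "\<And>s. s \<in> S \<Longrightarrow> f s \<in> alg_span T"
    and "f 0 = 0" "\<And>a b. f (a + b) = f a + f b" "\<And>c a. f (scale c a) = scale c (f a)"
  shows "f a \<in> alg_span T"
  using assms(1)
proof (induction rule: alg.span_induct_alt)
  case base
  show ?case by (simp add: assms(3) alg.span_zero)
next
  case (step c s b)
  thus ?case
    by (simp add: assms alg.span_add alg.span_scale)
qed

lemma span_mult_left_closed:
  assumes "a \<in> alg_span S" "\<And>s. s \<in> S \<Longrightarrow> r * s \<in> alg_span T"
  shows "r * a \<in> alg_span T"
  using assms by (rule span_image_closed) (auto simp: distrib_left scale_mult_right)

lemma span_mult_right_closed:
  assumes "a \<in> alg_span S" "\<And>s. s \<in> S \<Longrightarrow> s * r \<in> alg_span T"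
  shows "a * r \<in> alg_span T"
  using assms by (rule span_image_closed) (auto simp: distrib_right scale_mult_left)

section \<open>Commuting powers of \<open>x\<close> past powers of \<open>y\<close>\<close>

text \<open>By the relation, \<open>alg_x\<close> raises the shift of each factor it passes by one.
  An arbitrary integer shift allows iteration over powers of \<open>alg_x\<close> and, later, a
  negative starting shift.\<close>

lemma x_y_power:
  "alg_x * (alg_y + of_int i) ^ n = (alg_y + of_int (i + 1)) ^ n * (alg_x :: 'k::field alg)"
proof (induction n)
  case (Suc n)
  have xy: "alg_x * (alg_y + of_int i) = (alg_y + of_int (i + 1)) * (alg_x :: 'k alg)"
    using alg_relation[where 'k = 'k] mult_of_int_commute[of i "alg_x :: 'k alg"]
    by (simp add: algebra_simps)
  have "alg_x * (alg_y + of_int i) ^ Suc n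
      = (alg_y + of_int (i + 1)) * (alg_x * (alg_y + of_int i) ^ n :: 'k alg)"
    by (simp add: xy flip: mult.assoc)
  thus ?case
    by (simp add: Suc mult.assoc)
qed simp

lemma x_power_y_power:
  "alg_x ^ m * (alg_y + of_int i) ^ n
    = (alg_y + of_int (i + int m)) ^ n * (alg_x ^ m :: 'k::field alg)"
\<comment> \<open>The innermost \<open>alg_x\<close> moves first, so the hypothesis is applied at
  shift \<open>i + 1\<close>.\<close>
proof (induction m arbitrary: i)
  case (Suc m)
  have "alg_x ^ Suc m * (alg_y + of_int i) ^ n
      = alg_x ^ m * (alg_x * (alg_y + of_int i) ^ n :: 'k alg)"
    by (simp add: power_Suc2 mult.assoc del: power_Suc)
  also have "\<dots> = alg_x ^ m * (alg_y + of_int (i + 1)) ^ n * alg_x"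
    by (simp only: x_y_power mult.assoc)
  also have "\<dots> = (alg_y + of_int (i + int (Suc m))) ^ n * (alg_x ^ m * alg_x)"
    using Suc[of "i + 1"] by (simp add: add_ac flip: mult.assoc)
  finally show ?case
    by (simp only: power_Suc2)
qed simp

lemma w_eq: "w k l = ((alg_y + 1) ^ k - alg_y ^ k) * (alg_x ^ Suc l :: 'k::field alg)"
  using x_y_power[of 0 k, where 'k = 'k] by (simp add: w_def left_diff_distrib flip: mult.assoc)

section \<open>\<open>W\<close> is an ideal\<close>

lemma span_of_int_mult:
  assumes "a \<in> alg_span S"
  shows "of_int i * a \<in> alg_span S"
proof -
  have "of_nat n * a \<in> alg_span S" for n
    using alg.span_scale[OF assms, of "of_nat n"] by (simp add: scale_of_nat)
  thus ?thesis
    by (cases i rule: int_cases2) (auto simp: alg.span_neg)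
qed

text \<open>The opposite PBW ordering, in which left multiplication by \<open>alg_y\<close> and
  right multiplication by \<open>alg_x\<close> merely raise an exponent.\<close>

definition reversed_monomials :: "'k::field alg set"
  where "reversed_monomials = {alg_y ^ n * alg_x ^ m | m n. m \<ge> 1}"

lemma reversed_monomials_left_y:
  assumes "a \<in> alg_span reversed_monomials"
  shows "alg_y * a \<in> alg_span reversed_monomials"
  using assms
proof (rule span_mult_left_closed)
  fix s :: "'a alg" assume "s \<in> reversed_monomials"
  then obtain m n where "s = alg_y ^ n * alg_x ^ m" "m \<ge> 1"
    by (auto simp: reversed_monomials_def)
  hence "alg_y * s = alg_y ^ Suc n * alg_x ^ m" "m \<ge> 1"
    by (simp_all add: mult.assoc)
  thus "alg_y * s \<in> alg_span reversed_monomials"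
    unfolding reversed_monomials_def by (intro alg.span_base) blast
qed

lemma reversed_monomials_right_x:
  assumes "a \<in> alg_span reversed_monomials"
  shows "a * alg_x \<in> alg_span reversed_monomials"
  using assms
proof (rule span_mult_right_closed)
  fix s :: "'a alg" assume "s \<in> reversed_monomials"
  then obtain m n where "s = alg_y ^ n * alg_x ^ m" "m \<ge> 1"
    by (auto simp: reversed_monomials_def)
  hence "s * alg_x = alg_y ^ n * alg_x ^ Suc m" "Suc m \<ge> 1"
    by (simp_all add: power_Suc2 mult.assoc del: power_Suc)
  thus "s * alg_x \<in> alg_span reversed_monomials"
    unfolding reversed_monomials_def by (intro alg.span_base) blast
qed

lemma W_left_x:
  assumes "a \<in> W"
  shows "alg_x * a \<in> W"
  using assms unfolding W_def
proof (rule span_mult_left_closed)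
  fix s :: "'a alg" assume "s \<in> {alg_x ^ m * alg_y ^ n | m n. m \<ge> 1}"
  then obtain m n where "s = alg_x ^ m * alg_y ^ n"
    by blast
  hence "alg_x * s = alg_x ^ Suc m * alg_y ^ n" "Suc m \<ge> 1"
    by (simp_all add: mult.assoc)
  thus "alg_x * s \<in> alg_span {alg_x ^ m * alg_y ^ n | m n. m \<ge> 1}"
    by (intro alg.span_base) blast
qed

lemma W_right_y:
  assumes "a \<in> W"
  shows "a * alg_y \<in> W"
  using assms unfolding W_def
proof (rule span_mult_right_closed)
  fix s :: "'a alg" assume "s \<in> {alg_x ^ m * alg_y ^ n | m n. m \<ge> 1}"
  then obtain m n where "s = alg_x ^ m * alg_y ^ n" "m \<ge> 1"
    by blast
  hence "s * alg_y = alg_x ^ m * alg_y ^ Suc n" "m \<ge> 1"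
    by (simp_all add: power_Suc2 mult.assoc del: power_Suc)
  thus "s * alg_y \<in> alg_span {alg_x ^ m * alg_y ^ n | m n. m \<ge> 1}"
    by (intro alg.span_base) blast
qed

text \<open>Changing the order of a monomial only shifts \<open>alg_y\<close> by an integer. A power
  of the shifted \<open>alg_y\<close> is absorbed one factor at a time, using closure under
  \<open>alg_y\<close> on the outer side and under integer multiples.\<close>

lemma W_eq_span_reversed_monomials: "(W :: 'k::field alg set) = alg_span reversed_monomials"
proof (rule subset_antisym)
  have "alg_x ^ m * alg_y ^ n \<in> alg_span (reversed_monomials :: 'k alg set)" if "m \<ge> 1" for m n
  proof -
    have "(alg_y + of_int i) ^ n * alg_x ^ m \<in> alg_span (reversed_monomials :: 'k alg set)" for i
    proof (induction n)
      case 0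
      have "alg_y ^ 0 * alg_x ^ m \<in> (reversed_monomials :: 'k alg set)"
        using \<open>m \<ge> 1\<close> unfolding reversed_monomials_def by blast
      thus ?case
        by (simp add: alg.span_base)
    next
      case (Suc n)
      thus ?case
        by (simp add: mult.assoc distrib_right alg.span_add reversed_monomials_left_y
            span_of_int_mult)
    qed
    \<comment> \<open>The shift \<open>m\<close> is the one created when \<open>alg_x ^ m\<close>
      passes an unshifted power to its right.\<close>
    from this[of "int m"] show ?thesis
      using x_power_y_power[of m 0 n, where 'k = 'k] by simp
  qed
  thus "W \<subseteq> alg_span (reversed_monomials :: 'k alg set)"
    unfolding W_def by (intro alg.span_minimal alg.subspace_span) auto
  have "alg_y ^ n * alg_x ^ m \<in> (W :: 'k alg set)" if "m \<ge> 1" for m n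
  proof -
    have "alg_x ^ m * (alg_y + of_int i) ^ n \<in> (W :: 'k alg set)" for i
    proof (induction n)
      case 0
      have "alg_x ^ m * alg_y ^ 0 \<in> (W :: 'k alg set)"
        using \<open>m \<ge> 1\<close> unfolding W_def by (intro alg.span_base) blast
      thus ?case
        by simp
    next
      case (Suc n)
      let ?u = "alg_x ^ m * (alg_y + of_int i) ^ n :: 'k alg"
      have "?u * alg_y + of_int i * ?u \<in> W"
        using W_right_y[OF Suc] Suc unfolding W_def by (intro alg.span_add span_of_int_mult)
      also have "?u * alg_y + of_int i * ?u = alg_x ^ m * (alg_y + of_int i) ^ Suc n"
        by (simp only: power_Suc2 distrib_left mult.assoc mult_of_int_commute)
      finally show ?case .
    qed
    \<comment> \<open>Starting at \<open>- m\<close>, the shift created by the passage cancels and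
      leaves \<open>alg_y ^ n\<close>.\<close>
    from this[of "- int m"] show ?thesis
      using x_power_y_power[of m "- int m" n, where 'k = 'k] by simp
  qed
  thus "alg_span reversed_monomials \<subseteq> (W :: 'k alg set)"
    unfolding W_def reversed_monomials_def by (intro alg.span_minimal alg.subspace_span) auto
qed

lemma W_mult_closed:
  assumes "a \<in> W"
  shows "r * a \<in> W \<and> a * r \<in> W"
  using assms
\<comment> \<open>Since \<open>a * (alg_x * r) = (a * alg_x) * r\<close>, right products need the
  hypothesis at \<open>a * alg_x\<close>, and likewise at \<open>a * alg_y\<close>.\<close>
proof (induction r arbitrary: a rule: alg_induct)
  case zero
  show ?case by (simp add: W_def alg.span_zero)
next
  case one
  thus ?case by simp
next
  case (add r s)
  thus ?case
    by (simp add: W_def distrib_left distrib_right alg.span_add)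
next
  case (scale c r)
  thus ?case
    by (simp add: W_def scale_mult_left scale_mult_right alg.span_scale)
next
  case (x r)
  thus ?case
    using W_left_x reversed_monomials_right_x
    by (metis W_eq_span_reversed_monomials mult.assoc)
next
  case (y r)
  thus ?case
    using W_right_y reversed_monomials_left_y
    by (metis W_eq_span_reversed_monomials mult.assoc)
qed

lemma ideal_W: "ideal W ring_of_type_algebra"
  unfolding ideal_ring_of_type_algebra_iff
  using W_mult_closed by (auto simp: W_def alg.span_zero alg.span_add)

section \<open>\<open>W'\<close> and triangularity\<close>

lemma W'_eq_span: "W' = alg_span {w k l | k l. k \<ge> 1}"
proof (rule subset_antisym)
  show "W' \<subseteq> alg_span {w k l | k l. k \<ge> 1}"
    unfolding W'_def by (clarify, intro alg.span_sum)
      (auto intro!: alg.span_scale intro: alg.span_base)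
  show "alg_span {w k l | k l. k \<ge> 1} \<subseteq> (W' :: 'a alg set)"
  proof
    fix a :: "'a alg" assume "a \<in> alg_span {w k l | k l. k \<ge> 1}"
    thus "a \<in> W'"
    proof (induction rule: alg.span_induct_alt)
      case base
      show ?case
        unfolding W'_def by (auto intro!: exI[of _ "\<lambda>_ _. 0"])
    next
      case (step r s b)
      from step obtain k l where s: "s = w k l" "k \<ge> 1"
        by blast
      from step obtain c where fin: "finite {(k, l). c k l \<noteq> 0}"
        and supp: "\<And>k l. c k l \<noteq> 0 \<Longrightarrow> k \<ge> 1"
        and b: "b = (\<Sum>(k, l)\<in>{(k, l). c k l \<noteq> 0}. scale (c k l) (w k l))"
        unfolding W'_def by blast
      define d where "d = (\<lambda>i j. c i j + (if (i, j) = (k, l) then r else 0))"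
      \<comment> \<open>The coefficient at \<open>(k, l)\<close> may cancel to zero or become newly
        nonzero, so sums are compared over a common superset of both supports.\<close>
      define T where "T = insert (k, l) {(k, l). c k l \<noteq> 0}"
      have T: "finite T"
        using fin by (simp add: T_def)
      have sub: "{(k, l). d k l \<noteq> 0} \<subseteq> T"
        by (auto simp: d_def T_def)
      have "(\<Sum>(i, j)\<in>{(k, l). d k l \<noteq> 0}. scale (d i j) (w i j))
          = (\<Sum>(i, j)\<in>T. scale (d i j) (w i j))"
        by (rule sum.mono_neutral_left) (use T sub in auto)
      also have "\<dots> = (\<Sum>(i, j)\<in>T. scale (c i j) (w i j))
          + (\<Sum>q\<in>T. if q = (k, l) then scale r s else 0)"
        unfolding sum.distrib[symmetric]
        by (rule sum.cong) (auto simp: d_def s alg.scale_left_distrib split: if_splits)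
      also have "(\<Sum>(i, j)\<in>T. scale (c i j) (w i j)) = b"
        unfolding b by (rule sum.mono_neutral_right) (use T in \<open>auto simp: T_def\<close>)
      also have "(\<Sum>q\<in>T. if q = (k, l) then scale r s else 0) = scale r s"
        using T by (simp add: T_def)
      finally have "scale r s + b = (\<Sum>(i, j)\<in>{(k, l). d k l \<noteq> 0}. scale (d i j) (w i j))"
        by simp
      moreover have "finite {(k, l). d k l \<noteq> 0}"
        using finite_subset[OF sub T] .
      moreover have "\<forall>i j. d i j \<noteq> 0 \<longrightarrow> i \<ge> 1"
        using supp s(2) by (auto simp: d_def split: if_splits)
      ultimately show ?case
        unfolding W'_def by blast
    qed
  qed
qed

text \<open>With \<open>D k = (y + 1) ^ k - y ^ k\<close>, the recursion
  \<open>D (k + 1) = y * D k + D k + y ^ k\<close> drives the induction: \<open>y * D k\<close>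
  carries the old leading coefficient up one degree, \<open>y ^ k\<close> adds one to it, and
  \<open>D k\<close> has lower degree.\<close>

lemma shifted_power_leading_term:
  fixes z :: "'k::field alg"
  shows "((alg_y + 1) ^ Suc k - alg_y ^ Suc k) * z - of_nat (Suc k) * (alg_y ^ k * z)
    \<in> alg_span {alg_y ^ i * z | i. i < k}"
proof (induction k)
  case 0
  show ?case by (simp add: alg.span_zero)
next
  case (Suc k)
  let ?S = "\<lambda>k. alg_span {alg_y ^ i * z | i. i < k}"
  define p where "p = ((alg_y + 1) ^ Suc k - alg_y ^ Suc k) * z"
  define q where "q = p - of_nat (Suc k) * (alg_y ^ k * z)"
  have q: "q \<in> ?S k"
    using Suc by (simp only: p_def q_def)
  hence "alg_y * q \<in> ?S (Suc k)"
  proof (rule span_mult_left_closed)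
    fix s assume "s \<in> {alg_y ^ i * z | i. i < k}"
    then obtain i where "s = alg_y ^ i * z" "i < k"
      by blast
    hence "alg_y * s = alg_y ^ Suc i * z" "Suc i < Suc k"
      by (simp_all add: mult.assoc)
    thus "alg_y * s \<in> ?S (Suc k)"
      by (intro alg.span_base) blast
  qed
  moreover have "q + of_nat (Suc k) * (alg_y ^ k * z) \<in> ?S (Suc k)"
  proof (rule alg.span_add)
    show "q \<in> ?S (Suc k)"
      using q alg.span_mono[of "{alg_y ^ i * z | i. i < k}" "{alg_y ^ i * z | i. i < Suc k}"]
      by (auto intro: less_SucI)
    have "alg_y ^ k * z \<in> ?S (Suc k)"
      by (intro alg.span_base) blast
    thus "of_nat (Suc k) * (alg_y ^ k * z) \<in> ?S (Suc k)"
      unfolding scale_of_nat[symmetric] by (rule alg.span_scale)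
  qed
  ultimately have "alg_y * q + p \<in> ?S (Suc k)"
    by (simp add: q_def alg.span_add)
  moreover have "alg_y * q + p = ((alg_y + 1) ^ Suc (Suc k) - alg_y ^ Suc (Suc k)) * z
      - of_nat (Suc (Suc k)) * (alg_y ^ Suc k * z)"
  proof -
    have "alg_y * (of_nat (Suc k) * (alg_y ^ k * z)) = of_nat (Suc k) * (alg_y ^ Suc k * z)"
      using scale_mult_right[of alg_y "of_nat (Suc k)" "alg_y ^ k * z"]
      by (simp only: scale_of_nat power_Suc mult.assoc)
    hence "alg_y * q + p = alg_y * p + p - of_nat (Suc k) * (alg_y ^ Suc k * z)"
      by (simp only: q_def right_diff_distrib) simp
    also have "alg_y * p + p
        = ((alg_y + 1) ^ Suc (Suc k) - alg_y ^ Suc (Suc k)) * z - alg_y ^ Suc k * z"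
      unfolding p_def power_Suc[of _ "Suc k"]
      by (simp only: left_diff_distrib right_diff_distrib distrib_right mult.assoc mult_1_left) simp
    finally show ?thesis
      by (simp only: of_nat_Suc[of "Suc k"] distrib_right mult_1_left) simp
  qed
  ultimately show ?case
    by simp
qed

text \<open>The forward inclusion uses that \<open>W\<close> is an ideal; the reverse one solves a
  triangular system whose diagonal entries \<open>n + 1\<close> are invertible in characteristic
  zero.\<close>

lemma span_w_eq:
  "alg_span {w k l | k l. k \<ge> 1} = alg_span (reversed_monomials :: 'k::field_char_0 alg set)"
proof (rule subset_antisym)
  have "w k l \<in> (W :: 'k alg set)" for k l
  proof -
    \<comment> \<open>Once \<open>alg_x\<close> lies in the ideal \<open>W\<close>, so does
      \<open>w k l\<close>, a left multiple of \<open>alg_x ^ Suc l\<close>.\<close>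
    have "alg_x ^ Suc 0 * alg_y ^ 0 \<in> (W :: 'k alg set)"
      unfolding W_def by (intro alg.span_base CollectI exI[of _ "Suc 0"] exI[of _ 0]) simp
    hence "alg_x * alg_x ^ l \<in> (W :: 'k alg set)"
      using W_mult_closed by fastforce
    thus ?thesis
      by (simp add: w_eq W_mult_closed)
  qed
  thus "alg_span {w k l | k l. k \<ge> 1} \<subseteq> alg_span (reversed_monomials :: 'k alg set)"
    unfolding W_eq_span_reversed_monomials by (intro alg.span_minimal alg.subspace_span) auto
  have mem: "alg_y ^ n * alg_x ^ Suc l \<in> (alg_span {w k l | k l. k \<ge> 1} :: 'k alg set)"
    (is "_ \<in> ?V")
    for n l :: nat
  proof (induction n rule: less_induct)
    case (less n)
    let ?u = "alg_y ^ n * alg_x ^ Suc l :: 'k alg"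
    have "alg_span {alg_y ^ i * alg_x ^ Suc l | i. i < n} \<subseteq> ?V"
      using less.IH by (intro alg.span_minimal alg.subspace_span) blast
    \<comment> \<open>The difference of powers loses one degree, so \<open>y\<close>-degree
      \<open>n\<close> is reached by index \<open>Suc n\<close>, which also satisfies
      \<open>k \<ge> 1\<close>.\<close>
    hence "w (Suc n) l - of_nat (Suc n) * ?u \<in> ?V"
      using shifted_power_leading_term[of n "alg_x ^ Suc l"] unfolding w_eq by blast
    moreover have "w (Suc n) l \<in> ?V"
      by (intro alg.span_base) auto
    ultimately have "w (Suc n) l - (w (Suc n) l - of_nat (Suc n) * ?u) \<in> ?V"
      by (rule alg.span_diff[rotated])
    \<comment> \<open>Characteristic zero enters here: \<open>of_nat (Suc n)\<close> is nonzero in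
      the field, so the two scalars cancel.\<close>
    hence "scale (inverse (of_nat (Suc n))) (scale (of_nat (Suc n)) ?u) \<in> ?V"
      unfolding scale_of_nat by (intro alg.span_scale) simp
    thus ?case
      by (simp del: of_nat_Suc power_Suc)
  qed
  have "reversed_monomials \<subseteq> (alg_span {w k l | k l. k \<ge> 1} :: 'k alg set)"
  proof
    fix a :: "'k alg" assume "a \<in> reversed_monomials"
    then obtain m n where "a = alg_y ^ n * alg_x ^ m" "m \<ge> 1"
      unfolding reversed_monomials_def by blast
    thus "a \<in> alg_span {w k l | k l. k \<ge> 1}"
      using mem[of n "m - 1"] by simp
  qed
  thus "alg_span (reversed_monomials :: 'k alg set) \<subseteq> alg_span {w k l | k l. k \<ge> 1}"
    by (intro alg.span_minimal alg.subspace_span)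
qed

theorem corollary3p3:
  shows "ideal (W' :: 'k::field_char_0 alg set) (ring_of_type_algebra :: 'k alg ring) \<and>
         (W :: 'k alg set) = W'"
proof -
  have "(W :: 'k alg set) = W'"
    by (simp only: W_eq_span_reversed_monomials W'_eq_span span_w_eq)
  thus ?thesis
    using ideal_W by metis
qed

end
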